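(* Let $\langle k\rangle=(k,k-1,\dots,1)\in S_k$ and $\Phi(x,y)=\sum_{k\ge1}F_{\langle k\rangle}(x)y^k$. Then $$\Phi(x,y)=\frac{y(1+x-xy)-y\sqrt{(1+x-xy)^2-4x}}{2x(1-y)}.$$
   Context: A permutation $\alpha\in S_n$ contains a pattern $\tau\in S_k$ if there are indices $1\le i_1<\dots<i_k\le n$ with $(\alpha_{i_1},\dots,\alpha_{i_k})$ order-isomorphic to $\tau$; otherwise it avoids $\tau$. For a pattern $\tau$, $f_\tau(n)$ is the number of permutations in $S_n$ avoiding both $132$ and $\tau$ ($S_0$ consists of the empty permutation), and $F_\tau(x)=\sum_{n\ge0}f_\tau(n)x^n$. *)

theory Defs
  imports
    "HOL-Library.Sublist"
    "HOL-Combinatorics.Multiset_Permutations"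
    "HOL-Computational_Algebra.Computational_Algebra"
begin

section \<open>Pattern avoidance\<close>

text \<open>Permutations in \<open>S\<^sub>n\<close> are lists in one-line notation, i.e. elements of
  \<^term>\<open>permutations_of_set {1..n}\<close>.\<close>

definition order_isomorphic :: "nat list \<Rightarrow> nat list \<Rightarrow> bool" where
  "order_isomorphic \<sigma> \<tau> \<longleftrightarrow> length \<sigma> = length \<tau> \<and>
     (\<forall>i < length \<tau>. \<forall>j < length \<tau>. \<sigma> ! i < \<sigma> ! j \<longleftrightarrow> \<tau> ! i < \<tau> ! j)"

definition contains :: "nat list \<Rightarrow> nat list \<Rightarrow> bool" where
  "contains \<alpha> \<tau> \<longleftrightarrow> (\<exists>\<sigma>. subseq \<sigma> \<alpha> \<and> order_isomorphic \<sigma> \<tau>)"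

definition avoids :: "nat list \<Rightarrow> nat list \<Rightarrow> bool" where
  "avoids \<alpha> \<tau> \<longleftrightarrow> \<not> contains \<alpha> \<tau>"

definition f_count :: "nat list \<Rightarrow> nat \<Rightarrow> nat" where
  "f_count \<tau> n = card {\<alpha> \<in> permutations_of_set {1..n}. avoids \<alpha> [1, 3, 2] \<and> avoids \<alpha> \<tau>}"

definition decreasing :: "nat \<Rightarrow> nat list" where
  "decreasing k = rev [1..<Suc k]"


section \<open>Generating functions\<close>

definition F :: "nat list \<Rightarrow> rat fps" where
  "F \<tau> = Abs_fps (\<lambda>n. of_nat (f_count \<tau> n))"

text \<open>Bivariate series are series in \<open>y\<close> (outer variable) whose coefficients are series in
  \<open>x\<close> (inner variable). As \<open>x\<close> is not invertible there, quotients by \<open>2x(1 - y)\<close> are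
  taken in the fraction field, into which series embed via \<^const>\<open>to_fract\<close>.\<close>

definition x\<^sub>v :: "rat fps fps" where "x\<^sub>v = fps_const fps_X"

definition y\<^sub>v :: "rat fps fps" where "y\<^sub>v = fps_X"

definition \<Phi> :: "rat fps fps" where
  "\<Phi> = Abs_fps (\<lambda>k. if k = 0 then 0 else F (decreasing k))"

text \<open>The square root of a bivariate series with constant term 1 is the one that itself
  has constant term 1; see \<open>ex1_fps2_sqrt\<close> below.\<close>

definition fps2_sqrt :: "rat fps fps \<Rightarrow> rat fps fps" where
  "fps2_sqrt D = (THE S. S ^ 2 = D \<and> S $ 0 $ 0 = 1)"

fun sqrt_coeff :: "rat fps fps \<Rightarrow> rat fps \<Rightarrow> nat \<Rightarrow> rat fps" where
  "sqrt_coeff D r n = (if n = 0 then r else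
     (D $ n - (\<Sum>i\<in>{1..<n}. sqrt_coeff D r i * sqrt_coeff D r (n - i))) * inverse (2 * r))"

declare sqrt_coeff.simps [simp del]

lemma ex1_fps2_sqrt:
  fixes D :: "rat fps fps"
  assumes "D $ 0 $ 0 = 1"
  shows "\<exists>!S. S ^ 2 = D \<and> S $ 0 $ 0 = 1"
proof (rule ex_ex1I)
  define r where "r = fps_radical (\<lambda>_ _. 1) (Suc 1) (D $ 0)"
  have r2: "r ^ 2 = D $ 0"
    using power_radical[of "D $ 0" "\<lambda>_ _. 1" 1] assms by (simp add: r_def numeral_2_eq_2)
  have r0: "r $ 0 = 1"
    by (simp add: r_def)
  have "(2 * r) $ 0 \<noteq> 0"
    by (simp add: r0)
  hence u: "inverse (2 * r) * (2 * r) = 1"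
    by (rule inverse_mult_eq_1)
  define S where "S = Abs_fps (sqrt_coeff D r)"
  have S0: "S $ 0 = r"
    by (simp add: S_def sqrt_coeff.simps)
  have "(S ^ 2) $ n = D $ n" for n
  proof (cases "n = 0")
    case True
    thus ?thesis using S0 r2 by (simp add: power2_eq_square)
  next
    case False
    let ?T = "\<Sum>i\<in>{1..<n}. S $ i * S $ (n - i)"
    have split: "{0..n} = insert 0 (insert n {1..<n})"
      using False by auto
    have "(S ^ 2) $ n = (\<Sum>i\<in>{0..n}. S $ i * S $ (n - i))"
      by (simp add: power2_eq_square fps_mult_nth)
    also have "\<dots> = S $ n * (2 * r) + ?T"
      unfolding split using False S0 by (simp add: algebra_simps)
    also have "S $ n = (D $ n - ?T) * inverse (2 * r)"
      using False by (simp add: S_def) (subst sqrt_coeff.simps, simp)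
    also have "(D $ n - ?T) * inverse (2 * r) * (2 * r) = D $ n - ?T"
      by (simp only: mult.assoc u mult_1_right)
    finally show ?thesis by simp
  qed
  thus "\<exists>S. S ^ 2 = D \<and> S $ 0 $ 0 = 1"
    using S0 r0 by (metis fps_ext)
next
  fix S T :: "rat fps fps"
  assume S: "S ^ 2 = D \<and> S $ 0 $ 0 = 1" and T: "T ^ 2 = D \<and> T $ 0 $ 0 = 1"
  hence "S = T \<or> S = - T"
    by (metis power2_eq_iff)
  moreover have "S \<noteq> - T"
  proof
    assume "S = - T"
    hence "S $ 0 $ 0 = - (T $ 0 $ 0)" by simp
    thus False using S T by simp
  qed
  ultimately show "S = T" by blast
qed

end

theory Submission
  imports Defs
begin

text \<open>A 132-avoiding permutation splits at its maximum as \<open>\<beta>' m \<gamma>\<close> with every entry of \<open>\<beta>'\<close>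
  larger than every entry of \<open>\<gamma>\<close>. The longest decreasing subsequence of the whole has length
  \<open>max (lds \<beta>') 1 + lds \<gamma>\<close>, since the maximum extends a decreasing subsequence on the left only if
  \<open>\<beta>'\<close> is empty. Hence the series \<open>L\<close> counting 132-avoiders by size (in \<open>x\<close>) and \<open>lds\<close> (in \<open>y\<close>)
  satisfies the quadratic equation \<open>L = 1 + x (L - 1 + y) L\<close>. Avoiding \<open>\<langle>k\<rangle>\<close> means \<open>lds < k\<close>, so
  \<open>\<Phi> = y L / (1 - y)\<close>, and the formula is the root of the quadratic that is a power series.\<close>

section \<open>Pattern occurrences\<close>

definition av132 :: "nat list \<Rightarrow> bool" where
  "av132 xs \<longleftrightarrow> (\<forall>a b c. subseq [a, b, c] xs \<longrightarrow> \<not> (a < c \<and> c < b))"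

lemma subseq_set_subset: "subseq xs ys \<Longrightarrow> set xs \<subseteq> set ys"
  unfolding subseq_conv_nths by (metis set_nths_subset)

lemma avoids_132_iff: "avoids xs [1, 3, 2] \<longleftrightarrow> av132 xs"
proof -
  have "order_isomorphic s [1, 3, 2] \<longleftrightarrow> (\<exists>a b c. s = [a, b, c] \<and> a < c \<and> c < b)" for s
    unfolding order_isomorphic_def
    by (auto simp: less_Suc_eq length_Suc_conv numeral_3_eq_3 numeral_2_eq_2)
  thus ?thesis
    unfolding avoids_def contains_def av132_def by metis
qed

text \<open>With 0-based indices the entry of \<open>decreasing k\<close> at \<open>i\<close> is
  \<open>k - i\<close>, so being order-isomorphic to it amounts to being strictly decreasing of
  length \<open>k\<close>.\<close>

lemma contains_decreasing_iff:
  "contains xs (decreasing k) \<longleftrightarrow>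
     (\<exists>s. subseq s xs \<and> sorted_wrt (>) s \<and> length s = k)"
proof -
  have nth: "decreasing k ! i = k - i" if "i < k" for i
    using that by (simp add: decreasing_def rev_nth del: upt_Suc)
  have len: "length (decreasing k) = k"
    by (simp add: decreasing_def)
  have "order_isomorphic s (decreasing k) \<longleftrightarrow> sorted_wrt (>) s \<and> length s = k" for s
  proof
    assume "order_isomorphic s (decreasing k)"
    hence ord: "s ! i < s ! j \<longleftrightarrow> k - i < k - j" if "i < k" "j < k" for i j
      using that by (auto simp: order_isomorphic_def len nth)
    moreover have "length s = k"
      using \<open>order_isomorphic s (decreasing k)\<close> by (simp add: order_isomorphic_def len)
    ultimately show "sorted_wrt (>) s \<and> length s = k"
      by (auto simp: sorted_wrt_iff_nth_less ord)
  next
    assume *: "sorted_wrt (>) s \<and> length s = k"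
    have "s ! i < s ! j \<longleftrightarrow> k - i < k - j" if "i < k" "j < k" for i j
      using * that sorted_wrt_nth_less[of "(>)" s i j] sorted_wrt_nth_less[of "(>)" s j i]
      by (cases i j rule: linorder_cases) auto
    thus "order_isomorphic s (decreasing k)"
      using * by (auto simp: order_isomorphic_def nth len)
  qed
  thus ?thesis unfolding contains_def by auto
qed

section \<open>Longest decreasing subsequences\<close>

definition lds :: "nat list \<Rightarrow> nat" where
  "lds xs = Max (length ` {s. subseq s xs \<and> sorted_wrt (>) s})"

lemma finite_decreasing_subseqs: "finite {s. subseq s xs \<and> sorted_wrt (>) s}"
  by (rule finite_subset[of _ "set (subseqs xs)"]) auto

lemma length_le_lds: "subseq s xs \<Longrightarrow> sorted_wrt (>) s \<Longrightarrow> length s \<le> lds xs"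
  unfolding lds_def using finite_decreasing_subseqs by (intro Max_ge) auto

lemma lds_witness: "\<exists>s. subseq s xs \<and> sorted_wrt (>) s \<and> length s = lds xs"
proof -
  have "lds xs \<in> length ` {s. subseq s xs \<and> sorted_wrt (>) s}"
    unfolding lds_def
    by (rule Max_in) (use finite_decreasing_subseqs in \<open>auto intro!: exI[of _ "[]"]\<close>)
  thus ?thesis by auto
qed

lemma lds_eqI:
  assumes "subseq s xs" "sorted_wrt (>) s" "length s = n"
    and "\<And>t. subseq t xs \<Longrightarrow> sorted_wrt (>) t \<Longrightarrow> length t \<le> n"
  shows "lds xs = n"
  using assms length_le_lds[of s xs] lds_witness[of xs] by (metis le_antisym)

text \<open>Prefixes of a longest decreasing subsequence are decreasing, so every length up to
  \<open>lds xs\<close> occurs. For \<open>k = 0\<close> both sides are false.\<close>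

lemma avoids_decreasing_iff: "avoids xs (decreasing k) \<longleftrightarrow> lds xs < k"
proof -
  have "contains xs (decreasing k) \<longleftrightarrow> k \<le> lds xs"
  proof
    assume "contains xs (decreasing k)"
    thus "k \<le> lds xs" unfolding contains_decreasing_iff by (metis length_le_lds)
  next
    assume k: "k \<le> lds xs"
    obtain s where s: "subseq s xs" "sorted_wrt (>) s" "length s = lds xs"
      using lds_witness by meson
    have "subseq (take k s) xs"
      using s(1) by (metis prefix_imp_subseq subseq_order.trans take_is_prefix)
    moreover have "sorted_wrt (>) (take k s)" "length (take k s) = k"
      using s k by (simp_all add: sorted_wrt_take)
    ultimately show "contains xs (decreasing k)"
      unfolding contains_decreasing_iff by metis
  qed
  thus ?thesis by (auto simp: avoids_def)
qed

lemma lds_Nil [simp]: "lds [] = 0"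
  by (rule lds_eqI[of "[]"]) auto

lemma lds_pos: "xs \<noteq> [] \<Longrightarrow> 0 < lds xs"
  using length_le_lds[of "[hd xs]" xs] by (cases xs) auto

text \<open>Decreasing subsequences of the two blocks can be concatenated because \<open>ys\<close>
  lies below \<open>xs\<close>; conversely, each one of the whole list cuts into two such
  pieces.\<close>

lemma lds_append:
  assumes "\<forall>x\<in>set xs. \<forall>y\<in>set ys. y < x"
  shows "lds (xs @ ys) = lds xs + lds ys"
proof -
  obtain s t where s: "subseq s xs" "sorted_wrt (>) s" "length s = lds xs"
    and t: "subseq t ys" "sorted_wrt (>) t" "length t = lds ys"
    using lds_witness by meson
  show ?thesis
  proof (rule lds_eqI[of "s @ t"])
    show "subseq (s @ t) (xs @ ys)" using s t by (simp add: list_emb_append_mono)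
    have "set s \<subseteq> set xs" "set t \<subseteq> set ys"
      using s(1) t(1) by (simp_all add: subseq_set_subset)
    thus "sorted_wrt (>) (s @ t)" using s(2) t(2) assms by (auto simp: sorted_wrt_append)
    show "length (s @ t) = lds xs + lds ys" using s t by simp
  next
    fix u assume u: "subseq u (xs @ ys)" "sorted_wrt (>) u"
    from u(1) obtain u1 u2 where u12: "u = u1 @ u2" "subseq u1 xs" "subseq u2 ys"
      by (rule subseq_appendE)
    hence "sorted_wrt (>) u1" "sorted_wrt (>) u2"
      using u(2) by (simp_all add: sorted_wrt_append)
    thus "length u \<le> lds xs + lds ys"
      using u12 by (simp add: add_mono length_le_lds)
  qed
qed

lemma lds_snoc_Max:
  assumes "\<forall>x\<in>set xs. x < m"
  shows "lds (xs @ [m]) = max (lds xs) 1"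
proof -
  obtain s where s: "subseq s xs" "sorted_wrt (>) s" "length s = lds xs"
    using lds_witness by meson
  \<comment> \<open>If \<open>xs\<close> is empty, the new entry alone attains the value 1;
    otherwise a longest decreasing subsequence of \<open>xs\<close> still does.\<close>
  define t where "t = (if lds xs = 0 then [m] else s)"
  show ?thesis
  proof (rule lds_eqI[of t])
    show "subseq t (xs @ [m])" "sorted_wrt (>) t" "length t = max (lds xs) 1"
      using s by (auto simp: t_def)
  next
    fix u assume u: "subseq u (xs @ [m])" "sorted_wrt (>) u"
    from u(1) obtain u1 u2 where u12: "u = u1 @ u2" "subseq u1 xs" "subseq u2 [m]"
      by (rule subseq_appendE)
    show "length u \<le> max (lds xs) 1"
    proof (cases "u1 = [] \<or> u2 = []")
      case True
      moreover have "length u1 \<le> lds xs"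
        using u(2) u12 by (simp add: sorted_wrt_append length_le_lds)
      ultimately show ?thesis
        using u12(1) list_emb_length[OF u12(3)] by auto
    next
      \<comment> \<open>A decreasing subsequence cannot reach \<open>m\<close> from an earlier
        entry, since all of those are smaller.\<close>
      case False
      then obtain a b where ab: "a \<in> set u1" "b \<in> set u2" by (meson list.set_sel(1))
      have "a < m" "b = m"
        using ab assms subseq_set_subset[OF u12(2)] subseq_set_subset[OF u12(3)] by auto
      moreover have "b < a" using ab u(2) u12(1) by (simp add: sorted_wrt_append)
      ultimately show ?thesis by simp
    qed
  qed
qed

section \<open>Invariance under shifting all values\<close>

lemma subseq_map_iff_ex: "subseq s (map f xs) \<longleftrightarrow> (\<exists>t. subseq t xs \<and> s = map f t)"
  by (metis subseq_map subseq_conv_nths nths_map)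

lemma lds_map_add [simp]: "lds (map ((+) c) xs) = lds xs"
proof -
  have "{s. subseq s (map ((+) c) xs) \<and> sorted_wrt (>) s} =
      map ((+) c) ` {s. subseq s xs \<and> sorted_wrt (>) s}"
    by (auto simp: subseq_map_iff_ex sorted_wrt_map)
  thus ?thesis by (simp add: lds_def image_image)
qed

lemma av132_map_add [simp]: "av132 (map ((+) c) xs) = av132 xs"
proof -
  have "subseq s (map ((+) c) xs) \<longleftrightarrow> (\<exists>t. subseq t xs \<and> s = map ((+) c) t)" for s
    by (rule subseq_map_iff_ex)
  hence "(\<exists>u v w. subseq [u, v, w] (map ((+) c) xs) \<and> u < w \<and> w < v) \<longleftrightarrow>
      (\<exists>u v w. subseq [u, v, w] xs \<and> u < w \<and> w < v)"
    by (simp add: Cons_eq_map_conv) (metis add_less_cancel_left)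
  thus ?thesis unfolding av132_def by metis
qed

text \<open>Entries \<open>x < y\<close> on the two sides of \<open>m\<close> would form a 132 with
  \<open>m\<close> as its 3. Conversely, once the left block lies above the right one, no occurrence
  can straddle the maximum.\<close>

lemma av132_append_Max_iff:
  assumes "distinct (xs @ m # ys)" "\<forall>x\<in>set xs \<union> set ys. x < m"
  shows "av132 (xs @ m # ys) \<longleftrightarrow> av132 xs \<and> av132 ys \<and> (\<forall>x\<in>set xs. \<forall>y\<in>set ys. y < x)"
proof
  assume av: "av132 (xs @ m # ys)"
  have "av132 xs" "av132 ys"
    using av unfolding av132_def by (meson list_emb_append2 list_emb_Cons subseq_rev_drop_many)+
  moreover have "y < x" if "x \<in> set xs" "y \<in> set ys" for x y
  proof -
    have "subseq ([x] @ [m] @ [y]) (xs @ [m] @ ys)"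
      using that by (intro list_emb_append_mono) (auto simp: subseq_singleton_left)
    hence "\<not> (x < y \<and> y < m)" using av by (auto simp: av132_def)
    moreover have "x \<noteq> y" "y < m" using assms that by auto
    ultimately show ?thesis by linarith
  qed
  ultimately show "av132 xs \<and> av132 ys \<and> (\<forall>x\<in>set xs. \<forall>y\<in>set ys. y < x)" by blast
next
  assume R: "av132 xs \<and> av132 ys \<and> (\<forall>x\<in>set xs. \<forall>y\<in>set ys. y < x)"
  have "\<not> (a < c \<and> c < b)" if abc: "subseq [a, b, c] (xs @ m # ys)" for a b c
  proof -
    obtain u v where uv: "[a, b, c] = u @ v" "subseq u xs" "subseq v (m # ys)"
      using abc by (rule subseq_appendE)
    have lt: "x < m" if "x \<in> set xs \<or> x \<in> set ys" for x
      using assms(2) that by blast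
    have sub: "set u \<subseteq> set xs" "set v \<subseteq> insert m (set ys)"
      using uv(2,3)[THEN subseq_set_subset] by simp_all
    have "u = [] \<and> v = [a, b, c] \<or> u = [a] \<and> v = [b, c] \<or> u = [a, b] \<and> v = [c] \<or> u = [a, b, c]"
      using uv(1) by (simp add: Cons_eq_append_conv) metis
    \<comment> \<open>The cases record how many of the three entries come from the left
      block.\<close>
    then consider "u = []" "v = [a, b, c]" | "u = [a]" "v = [b, c]" | "u = [a, b]" "v = [c]" | "u = [a, b, c]"
      by metis
    thus ?thesis
    proof cases
      case 1
      show ?thesis
      proof (cases "a = m")
        case True
        have "c < a" if "c \<noteq> m" using True lt[of c] sub(2) 1(2) that by simp
        thus ?thesis using True by linarith
      next
        case False
        hence "subseq [a, b, c] ys"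
          using uv(3) unfolding 1(2) by (metis subseq_Cons2_neq)
        thus ?thesis using R unfolding av132_def by metis
      qed
    next
      case 2
      \<comment> \<open>The entry \<open>c\<close> is preceded by \<open>b\<close> within
        \<open>m # ys\<close>, so it lies in \<open>ys\<close> and hence below
        \<open>a\<close>.\<close>
      have "subseq [c] ys"
      proof (cases "b = m")
        case True
        thus ?thesis using uv(3) 2 by simp
      next
        case False
        hence "subseq [b, c] ys"
          using uv(3) unfolding 2(2) by (metis subseq_Cons2_neq)
        thus ?thesis by (rule subseq_Cons')
      qed
      hence "c < a" using R sub 2 by (simp add: subseq_singleton_left)
      thus ?thesis by simp
    next
      case 3
      hence "b < m" "c = m \<or> c < a" using lt[of b] R sub by auto
      thus ?thesis by linarith
    next
      case 4
      thus ?thesis using R uv(2) unfolding av132_def by metis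
    qed
  qed
  thus "av132 (xs @ m # ys)" unfolding av132_def by metis
qed

section \<open>Decomposition at the maximum\<close>

definition Av132 :: "nat \<Rightarrow> nat list set" where
  "Av132 n = {\<alpha> \<in> permutations_of_set {1..n}. av132 \<alpha>}"

text \<open>This inverts the splitting at the maximum: the shift lifts \<beta>, given in
  standardised form, above the values of \<gamma>.\<close>

definition join :: "nat list \<Rightarrow> nat list \<Rightarrow> nat list" where
  "join \<beta> \<gamma> = map ((+) (length \<gamma>)) \<beta> @ Suc (length \<beta> + length \<gamma>) # \<gamma>"

lemma Av132_iff: "\<alpha> \<in> Av132 n \<longleftrightarrow> set \<alpha> = {1..n} \<and> distinct \<alpha> \<and> av132 \<alpha>"
  by (auto simp: Av132_def permutations_of_set_def)

lemma finite_Av132 [simp]: "finite (Av132 n)"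
  by (simp add: Av132_def)

lemma length_Av132: "\<alpha> \<in> Av132 n \<Longrightarrow> length \<alpha> = n"
  by (auto simp: Av132_iff dest!: distinct_card)

lemma Av132_0: "Av132 0 = {[]}"
  by (auto simp: Av132_iff av132_def)

lemma
  assumes "\<beta> \<in> Av132 i" "\<gamma> \<in> Av132 j"
  shows join_in_Av132: "join \<beta> \<gamma> \<in> Av132 (Suc (i + j))"
    and lds_join: "lds (join \<beta> \<gamma>) = max (lds \<beta>) 1 + lds \<gamma>"
proof -
  have len: "length \<beta> = i" "length \<gamma> = j" using assms by (auto simp: length_Av132)
  have \<beta>: "set \<beta> = {1..i}" "distinct \<beta>" "av132 \<beta>" and \<gamma>: "set \<gamma> = {1..j}" "distinct \<gamma>" "av132 \<gamma>"
    using assms by (auto simp: Av132_iff)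
  let ?xs = "map ((+) j) \<beta>" and ?m = "Suc (i + j)"
  have join: "join \<beta> \<gamma> = ?xs @ ?m # \<gamma>" by (simp add: join_def len)
  have set: "set ?xs = {j + 1..i + j}" using \<beta> by (simp add: image_add_atLeastAtMost add.commute)
  have dist: "distinct (?xs @ ?m # \<gamma>)"
    using \<beta> \<gamma> set by (auto simp: distinct_map)
  have "av132 (?xs @ ?m # \<gamma>)"
    using \<beta> \<gamma> set by (subst av132_append_Max_iff[OF dist]) auto
  moreover have "set (?xs @ ?m # \<gamma>) = {1..?m}"
    unfolding set_append list.set(2) set \<gamma>(1) by auto
  ultimately show "join \<beta> \<gamma> \<in> Av132 (Suc (i + j))"
    using dist by (simp only: Av132_iff join)
  \<comment> \<open>The maximum is grouped with the left block, because both lie entirely above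
    \<gamma>.\<close>
  have "lds ((?xs @ [?m]) @ \<gamma>) = lds (?xs @ [?m]) + lds \<gamma>"
    using \<gamma> set by (intro lds_append) auto
  also have "lds (?xs @ [?m]) = max (lds ?xs) 1"
    using set by (intro lds_snoc_Max) auto
  finally show "lds (join \<beta> \<gamma>) = max (lds \<beta>) 1 + lds \<gamma>" by (simp add: join)
qed

text \<open>Equal total sizes give the same maximal value. It occurs only once in each list, so its
  position separates the blocks; the length of \<gamma> then determines the shift to undo.\<close>

lemma join_inject:
  assumes "\<beta> \<in> Av132 i" "\<gamma> \<in> Av132 j" "\<beta>' \<in> Av132 i'" "\<gamma>' \<in> Av132 j'" "i + j = i' + j'"
    and eq: "join \<beta> \<gamma> = join \<beta>' \<gamma>'"
  shows "\<beta> = \<beta>' \<and> \<gamma> = \<gamma>'"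
proof -
  have len: "length \<beta> = i" "length \<gamma> = j" "length \<beta>' = i'" "length \<gamma>' = j'"
    using assms(1-4) by (simp_all add: length_Av132)
  have sets: "set \<beta> = {1..i}" "set \<gamma> = {1..j}" "set \<beta>' = {1..i'}" "set \<gamma>' = {1..j'}"
    using assms(1-4) by (simp_all add: Av132_iff)
  have "Suc (i + j) \<notin> set (map ((+) j) \<beta>)" "Suc (i + j) \<notin> set \<gamma>"
    by (auto simp: sets)
  hence "map ((+) j) \<beta> = map ((+) j') \<beta>' \<and> \<gamma> = \<gamma>'"
    using eq unfolding join_def len assms(5)[symmetric] by (simp add: append_Cons_eq_iff)
  moreover from this have "j = j'" using len by blast
  ultimately show ?thesis by (simp add: inj_map_eq_map)
qed

text \<open>Anything in the range below an element of \<open>Y\<close> cannot lie in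
  \<open>X\<close>, so \<open>Y\<close> is an initial interval. This identifies the value sets of
  the blocks around the maximum.\<close>

lemma upper_lower_split:
  fixes X Y :: "nat set"
  assumes "X \<union> Y = {1..n}" "\<forall>x\<in>X. \<forall>y\<in>Y. y < x"
  shows "Y = {1..card Y}" "X = {card Y + 1..n}"
proof -
  have "finite Y" using assms by (metis finite_Un finite_atLeastAtMost)
  have "\<exists>j\<le>n. Y = {1..j}"
  proof (cases "Y = {}")
    case False
    have "Max Y \<in> Y" using False \<open>finite Y\<close> by simp
    moreover have "v \<in> Y" if "1 \<le> v" "v \<le> Max Y" for v
    proof -
      have "Max Y \<in> {1..n}" using assms(1) \<open>Max Y \<in> Y\<close> by blast
      hence "v \<in> X \<union> Y" using that assms(1) by simp
      thus ?thesis using assms(2) \<open>Max Y \<in> Y\<close> that(2) by force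
    qed
    moreover have "1 \<le> v \<and> v \<le> n" if "v \<in> Y" for v
      using that assms(1) by (metis UnCI atLeastAtMost_iff)
    moreover have "v \<le> Max Y" if "v \<in> Y" for v
      using \<open>finite Y\<close> that by simp
    ultimately have "v \<in> Y \<longleftrightarrow> v \<in> {1..Max Y}" for v
      unfolding atLeastAtMost_iff by metis
    hence "Y = {1..Max Y}" by (rule set_eqI)
    moreover have "Max Y \<le> n"
      using assms(1) \<open>Max Y \<in> Y\<close> by (metis UnCI atLeastAtMost_iff)
    ultimately show ?thesis by blast
  qed auto
  then obtain j where j: "j \<le> n" "Y = {1..j}" by blast
  thus Y: "Y = {1..card Y}" by simp
  have "X \<inter> Y = {}" using assms(2) by fastforce
  hence "X = {1..n} - Y" using assms(1) by blast
  thus "X = {card Y + 1..n}" using j by auto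
qed

text \<open>This is surjectivity of \<open>join\<close>: the block after the maximum uses an initial
  interval of values, and the block before it becomes a permutation after a downward shift.\<close>

lemma Av132_Suc_decompose:
  assumes "\<alpha> \<in> Av132 (Suc n)"
  obtains i \<beta> \<gamma> where "i \<le> n" "\<beta> \<in> Av132 i" "\<gamma> \<in> Av132 (n - i)" "\<alpha> = join \<beta> \<gamma>"
proof -
  have \<alpha>: "set \<alpha> = {1..Suc n}" "distinct \<alpha>" "av132 \<alpha>" using assms by (auto simp: Av132_iff)
  hence "Suc n \<in> set \<alpha>" by simp
  then obtain xs ys where split: "\<alpha> = xs @ Suc n # ys" by (meson split_list)
  have un: "set xs \<union> set ys = {1..n}"
  proof -
    have "set xs \<union> set ys = set \<alpha> - {Suc n}" using \<alpha>(2) split by auto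
    also have "\<dots> = {1..n}" unfolding \<alpha>(1) by auto
    finally show ?thesis .
  qed
  hence "\<forall>x\<in>set xs \<union> set ys. x < Suc n" by auto
  hence av: "av132 xs" "av132 ys" "\<forall>x\<in>set xs. \<forall>y\<in>set ys. y < x"
    using \<alpha>(2,3) av132_append_Max_iff[of xs "Suc n" ys] unfolding split by simp_all
  define j where "j = length ys"
  have j: "card (set ys) = j" using \<alpha>(2) split by (simp add: j_def distinct_card)
  have ys: "set ys = {1..j}" and xs: "set xs = {j + 1..n}"
    using upper_lower_split[OF un av(3)] j by auto
  have jn: "length xs + j = n"
    using length_Av132[OF assms] split by (simp add: j_def)
  \<comment> \<open>All entries of \<open>xs\<close> exceed \<open>j\<close>, so the truncated
    subtraction is exact and adding \<open>j\<close> undoes it.\<close>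
  define \<beta> where "\<beta> = map (\<lambda>v. v - j) xs"
  have xs_eq: "xs = map ((+) j) \<beta>"
    unfolding \<beta>_def map_map by (rule sym, rule map_idI) (use xs in auto)
  have "v \<in> set \<beta> \<longleftrightarrow> v \<in> {1..n - j}" for v
  proof -
    have "v \<in> set \<beta> \<longleftrightarrow> j + v \<in> set xs" unfolding xs_eq by auto
    thus ?thesis using jn by (auto simp: xs)
  qed
  hence "set \<beta> = {1..n - j}" by blast
  moreover have "distinct \<beta>" "av132 \<beta>"
    using \<alpha>(2) split av(1) xs_eq by (auto simp: distinct_map)
  ultimately have "\<beta> \<in> Av132 (n - j)" by (simp add: Av132_iff)
  moreover have "ys \<in> Av132 (n - (n - j))"
    using ys av(2) \<alpha>(2) split jn by (simp add: Av132_iff)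
  moreover have "\<alpha> = join \<beta> ys"
    unfolding split join_def j_def[symmetric] xs_eq[symmetric] using jn by (simp add: \<beta>_def)
  ultimately show ?thesis using that[of "n - j"] by simp
qed

section \<open>Generating functions\<close>

text \<open>The series \<open>L\<close> of the overview; as in \<Phi>, the outer index is the
  exponent of \<open>y\<close> and the inner one that of \<open>x\<close>.\<close>

definition lds_series :: "rat fps fps" where
  "lds_series = Abs_fps (\<lambda>k. Abs_fps (\<lambda>n. of_nat (card {\<alpha> \<in> Av132 n. lds \<alpha> = k})))"

text \<open>By \<open>join\<close>, the permutations correspond to pairs of blocks; \<open>p\<close>
  is the share of the left block together with the maximum. The double sum is shaped as the
  coefficient of a product of bivariate series.\<close>

lemma card_Av132_Suc:
  "card {\<alpha> \<in> Av132 (Suc n). lds \<alpha> = k} =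
     (\<Sum>p\<le>k. \<Sum>i\<le>n. card {\<beta> \<in> Av132 i. max (lds \<beta>) 1 = p} * card {\<gamma> \<in> Av132 (n - i). lds \<gamma> = k - p})"
proof -
  let ?B = "\<lambda>n k. {\<gamma> \<in> Av132 n. lds \<gamma> = k}" and ?C = "\<lambda>n k. {\<beta> \<in> Av132 n. max (lds \<beta>) 1 = k}"
  let ?S = "SIGMA p:{..k}. SIGMA i:{..n}. ?C i p \<times> ?B (n - i) (k - p)"
  have "bij_betw (\<lambda>(p, i, \<beta>, \<gamma>). join \<beta> \<gamma>) ?S (?B (Suc n) k)"
    unfolding bij_betw_def
  proof
    show "inj_on (\<lambda>(p, i, \<beta>, \<gamma>). join \<beta> \<gamma>) ?S"
    proof (rule inj_onI)
      fix s t assume st: "s \<in> ?S" "t \<in> ?S"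
        and "(\<lambda>(p, i, \<beta>, \<gamma>). join \<beta> \<gamma>) s = (\<lambda>(p, i, \<beta>, \<gamma>). join \<beta> \<gamma>) t"
      moreover obtain p i \<beta> \<gamma> p' i' \<beta>' \<gamma>' where [simp]: "s = (p, i, \<beta>, \<gamma>)" "t = (p', i', \<beta>', \<gamma>')"
        by (cases s, cases t) blast
      ultimately have *: "i \<le> n" "i' \<le> n" "\<beta> \<in> Av132 i" "\<beta>' \<in> Av132 i'" "\<gamma> \<in> Av132 (n - i)" "\<gamma>' \<in> Av132 (n - i')"
        and eq: "join \<beta> \<gamma> = join \<beta>' \<gamma>'" by simp_all
      have "\<beta> = \<beta>' \<and> \<gamma> = \<gamma>'"
        by (rule join_inject[OF *(3,5,4,6) _ eq]) (use * in simp)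
      \<comment> \<open>The remaining components are determined by \<beta>: \<open>i\<close> is its
        length and \<open>p\<close> is \<open>max (lds \<beta>) 1\<close>.\<close>
      moreover from this have "i = i'" using * length_Av132 by metis
      ultimately show "s = t" using st by simp
    qed
    show "(\<lambda>(p, i, \<beta>, \<gamma>). join \<beta> \<gamma>) ` ?S = ?B (Suc n) k"
    proof (intro equalityI subsetI)
      fix \<alpha> assume "\<alpha> \<in> (\<lambda>(p, i, \<beta>, \<gamma>). join \<beta> \<gamma>) ` ?S"
      then obtain i \<beta> \<gamma> where *: "i \<le> n" "\<beta> \<in> Av132 i" "\<gamma> \<in> Av132 (n - i)" "\<alpha> = join \<beta> \<gamma>"
        "max (lds \<beta>) 1 \<le> k" "lds \<gamma> = k - max (lds \<beta>) 1" by force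
      thus "\<alpha> \<in> ?B (Suc n) k"
        using join_in_Av132[OF *(2,3)] lds_join[OF *(2,3)] by simp
    next
      fix \<alpha> assume \<alpha>: "\<alpha> \<in> ?B (Suc n) k"
      then obtain i \<beta> \<gamma> where *: "i \<le> n" "\<beta> \<in> Av132 i" "\<gamma> \<in> Av132 (n - i)" "\<alpha> = join \<beta> \<gamma>"
        using Av132_Suc_decompose by blast
      have "k = max (lds \<beta>) 1 + lds \<gamma>" using \<alpha> * lds_join[OF *(2,3)] by simp
      hence "(max (lds \<beta>) 1, i, \<beta>, \<gamma>) \<in> ?S" using * by simp
      thus "\<alpha> \<in> (\<lambda>(p, i, \<beta>, \<gamma>). join \<beta> \<gamma>) ` ?S"
        by (rule rev_image_eqI) (simp add: *(4))
    qed
  qed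
  hence "card (?B (Suc n) k) = card ?S" by (simp add: bij_betw_same_card)
  also have "\<dots> = (\<Sum>p\<le>k. \<Sum>i\<le>n. card (?C i p) * card (?B (n - i) (k - p)))"
    by (simp add: card_SigmaI card_cartesian_product)
  finally show ?thesis .
qed

text \<open>Subtracting \<open>1\<close> and adding \<open>y\<close> corrects the empty left block: the maximum behind it
  still contributes a decreasing subsequence of length 1.\<close>

lemma lds_series_shift_nth:
  "(lds_series - 1 + y\<^sub>v) $ p $ i = of_nat (card {\<beta> \<in> Av132 i. max (lds \<beta>) 1 = p})"
proof (cases "i = 0")
  case True
  have "{\<beta> \<in> Av132 0. max (lds \<beta>) 1 = p} = (if p = 1 then {[]} else {})"
       "{\<beta> \<in> Av132 0. lds \<beta> = p} = (if p = 0 then {[]} else {})"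
    by (auto simp: Av132_0)
  thus ?thesis using True by (simp add: lds_series_def y\<^sub>v_def fps_X_nth fps_one_nth)
next
  case False
  have "max (lds \<beta>) 1 = lds \<beta>" if "\<beta> \<in> Av132 i" for \<beta>
  proof -
    have "\<beta> \<noteq> []" using length_Av132[OF that] False by auto
    thus ?thesis using lds_pos[of \<beta>] by simp
  qed
  hence "{\<beta> \<in> Av132 i. max (lds \<beta>) 1 = p} = {\<beta> \<in> Av132 i. lds \<beta> = p}" by auto
  thus ?thesis using False by (simp add: lds_series_def y\<^sub>v_def fps_X_nth fps_one_nth)
qed

text \<open>The summand 1 accounts for the empty permutation; the factor \<open>x\<^sub>v\<close>
  accounts for the maximum, and the product for the two blocks.\<close>

lemma lds_series_equation: "lds_series = 1 + x\<^sub>v * ((lds_series - 1 + y\<^sub>v) * lds_series)"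
proof (intro fps_ext)
  fix k n
  show "lds_series $ k $ n = (1 + x\<^sub>v * ((lds_series - 1 + y\<^sub>v) * lds_series)) $ k $ n"
  proof (cases n)
    case 0
    have "{\<beta> \<in> Av132 0. lds \<beta> = k} = (if k = 0 then {[]} else {})"
      by (auto simp: Av132_0)
    thus ?thesis using 0 by (simp add: lds_series_def x\<^sub>v_def fps_one_nth)
  next
    case (Suc m)
    have "(x\<^sub>v * ((lds_series - 1 + y\<^sub>v) * lds_series)) $ k $ n = ((lds_series - 1 + y\<^sub>v) * lds_series) $ k $ m"
      using Suc by (simp add: x\<^sub>v_def)
    also have "\<dots> = (\<Sum>p\<le>k. \<Sum>i\<le>m. (lds_series - 1 + y\<^sub>v) $ p $ i * lds_series $ (k - p) $ (m - i))"
      by (simp only: fps_mult_nth fps_sum_nth atLeast0AtMost)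
    also have "\<dots> = of_nat (card {\<alpha> \<in> Av132 (Suc m). lds \<alpha> = k})"
      unfolding card_Av132_Suc lds_series_shift_nth by (simp add: lds_series_def)
    also have "\<dots> = lds_series $ k $ n" using Suc by (simp add: lds_series_def)
    finally show ?thesis using Suc by (simp add: fps_one_nth)
  qed
qed

section \<open>Expressing \<Phi> through \<open>lds_series\<close>\<close>

lemma \<Phi>_nth: "\<Phi> $ k $ n = of_nat (card {\<alpha> \<in> Av132 n. lds \<alpha> < k})"
proof -
  have "f_count (decreasing k) n = card {\<alpha> \<in> Av132 n. lds \<alpha> < k}"
    unfolding f_count_def avoids_132_iff avoids_decreasing_iff Av132_def
    by (rule arg_cong[of _ _ card]) blast
  \<comment> \<open>At \<open>k = 0\<close> the coefficient 0 set by definition agrees with the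
    count, as no list has \<open>lds\<close> below 0.\<close>
  thus ?thesis by (simp add: \<Phi>_def F_def)
qed

text \<open>Multiplying by \<open>1 - y\<^sub>v\<close> takes differences in \<open>k\<close>,
  turning the cumulative counts \<open>lds < k\<close> into exact ones with
  \<open>lds = k - 1\<close>.\<close>

lemma one_minus_y_times_\<Phi>: "(1 - y\<^sub>v) * \<Phi> = y\<^sub>v * lds_series"
proof (intro fps_ext)
  fix k n
  show "((1 - y\<^sub>v) * \<Phi>) $ k $ n = (y\<^sub>v * lds_series) $ k $ n"
  proof (cases k)
    case 0
    thus ?thesis by (simp add: y\<^sub>v_def left_diff_distrib \<Phi>_nth)
  next
    case (Suc j)
    have "{\<alpha> \<in> Av132 n. lds \<alpha> < Suc j} = {\<alpha> \<in> Av132 n. lds \<alpha> < j} \<union> {\<alpha> \<in> Av132 n. lds \<alpha> = j}"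
      by auto
    hence "card {\<alpha> \<in> Av132 n. lds \<alpha> < Suc j} =
        card {\<alpha> \<in> Av132 n. lds \<alpha> < j} + card {\<alpha> \<in> Av132 n. lds \<alpha> = j}"
      by (simp add: card_Un_disjoint disjoint_iff)
    thus ?thesis using Suc by (simp add: y\<^sub>v_def left_diff_distrib \<Phi>_nth lds_series_def)
  qed
qed

section \<open>Solving the quadratic equation\<close>

text \<open>Completing the square: with \<open>B = 1 + x - x * y\<close> the hypothesis reads
  \<open>x * g^2 - B * g + 1 = 0\<close>, and multiplying by \<open>4 * x\<close> gives the
  claim.\<close>

lemma square_of_quadratic_root:
  fixes g x y :: "'a :: idom"
  assumes "g = 1 + x * ((g - 1 + y) * g)"
  shows "(1 + x - x * y - 2 * x * g) ^ 2 = (1 + x - x * y) ^ 2 - 4 * x"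
  using assms by algebra

text \<open>Of the two square roots, the one shown has constant term 1, which is the normalisation
  that \<open>fps2_sqrt\<close> selects; this settles the sign in the final formula.\<close>

lemma fps2_sqrt_discriminant:
  "fps2_sqrt ((1 + x\<^sub>v - x\<^sub>v * y\<^sub>v) ^ 2 - 4 * x\<^sub>v) = 1 + x\<^sub>v - x\<^sub>v * y\<^sub>v - 2 * x\<^sub>v * lds_series"
proof -
  let ?D = "(1 + x\<^sub>v - x\<^sub>v * y\<^sub>v) ^ 2 - 4 * x\<^sub>v" and ?S = "1 + x\<^sub>v - x\<^sub>v * y\<^sub>v - 2 * x\<^sub>v * lds_series"
  have "?S ^ 2 = ?D"
    by (rule square_of_quadratic_root[OF lds_series_equation])
  moreover have "?S $ 0 $ 0 = 1"
    by (simp add: x\<^sub>v_def y\<^sub>v_def mult.assoc)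
  moreover have "?D $ 0 $ 0 = 1"
    by (simp add: x\<^sub>v_def y\<^sub>v_def power2_eq_square fps_mult_nth_0 flip: mult.assoc)
  ultimately show ?thesis
    unfolding fps2_sqrt_def by (intro the1_equality ex1_fps2_sqrt) auto
qed

theorem theorem2p2:
  shows "to_fract \<Phi> =
    to_fract (y\<^sub>v * (1 + x\<^sub>v - x\<^sub>v * y\<^sub>v)
              - y\<^sub>v * fps2_sqrt ((1 + x\<^sub>v - x\<^sub>v * y\<^sub>v) ^ 2 - 4 * x\<^sub>v))
    / to_fract (2 * x\<^sub>v * (1 - y\<^sub>v))"
proof -
  let ?N = "y\<^sub>v * (1 + x\<^sub>v - x\<^sub>v * y\<^sub>v)
              - y\<^sub>v * fps2_sqrt ((1 + x\<^sub>v - x\<^sub>v * y\<^sub>v) ^ 2 - 4 * x\<^sub>v)"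
  have "\<Phi> * (2 * x\<^sub>v * (1 - y\<^sub>v)) = 2 * x\<^sub>v * ((1 - y\<^sub>v) * \<Phi>)" by (simp only: mult_ac)
  \<comment> \<open>After substitution both sides equal
    \<open>2 * x\<^sub>v * y\<^sub>v * lds_series\<close>.\<close>
  also have "\<dots> = ?N"
    unfolding one_minus_y_times_\<Phi> fps2_sqrt_discriminant by algebra
  finally have "to_fract ?N = to_fract \<Phi> * to_fract (2 * x\<^sub>v * (1 - y\<^sub>v))"
    by (metis to_fract_mult)
  moreover have "to_fract (2 * x\<^sub>v * (1 - y\<^sub>v)) \<noteq> 0"
  proof -
    \<comment> \<open>A nonzero denominator is what permits dividing in the fraction field.\<close>
    have "(1 - y\<^sub>v) $ 0 \<noteq> 0" by (simp add: y\<^sub>v_def)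
    hence "1 - y\<^sub>v \<noteq> 0" by (metis fps_zero_nth)
    hence "2 * x\<^sub>v * (1 - y\<^sub>v) \<noteq> 0" by (simp add: x\<^sub>v_def)
    thus ?thesis unfolding to_fract_eq_0_iff .
  qed
  ultimately show ?thesis by (metis nonzero_mult_div_cancel_right)
qed

end
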